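(* Let $\mathcal{X}$ be a set with $\sigma$-algebras $\Sigma\subseteq\mathcal{H}$, where $\mathcal{H}$ is in addition closed under arbitrary unions, so that $(\mathcal{X},\mathcal{H})$ is intersection-closed with least hypotheses $H_x$, $x\in\mathcal{X}$. Let $\mathcal{P}$ be a collection of probability measures on $(\mathcal{X},\mathcal{H})$ and let $\varepsilon:\mathcal{H}\times\mathcal{X}\to[0,\infty]$ be a predictive E-capacity kernel. Then, for every $x\in\mathcal{X}$, $$\sup_{H\in\mathcal{H}:H\ni x}\varepsilon(H\mid x)=\varepsilon(H_x\mid x).$$ As a consequence, $\varepsilon$ is (predictively) valid, i.e. $\mathbb{E}^P[\sup_{H\in\mathcal{H}:H\ni X}\varepsilon(H\mid X)]\le1$ for every $P\in\mathcal{P}$, if and only if $x\mapsto\varepsilon(H_x\mid x)$ is a valid $\mathcal{H}$-measurable E-variable for $\mathcal{P}$, i.e. is an $\mathcal{H}$-measurable map $\mathcal{X}\to[0,\infty]$ with $\mathbb{E}^P[\varepsilon(H_X\mid X)]\le1$ for every $P\in\mathcal{P}$.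
   Context: Here hypotheses are subsets of the sample space $\mathcal{X}$ (rather than sets of probability measures). $(\mathcal{X},\mathcal{H})$ is intersection-closed if $\mathcal{H}$ is closed under arbitrary unions (including the empty one) and arbitrary intersections and $\mathcal{X}\in\mathcal{H}$; the least hypothesis of $x\in\mathcal{X}$ is $H_x=\bigcap\{H\in\mathcal{H}:x\in H\}\in\mathcal{H}$. A predictive E-capacity kernel is a map $\varepsilon:\mathcal{H}\times\mathcal{X}\to[0,\infty]$, written $\varepsilon(H\mid x)$, such that $x\mapsto\varepsilon(H\mid x)$ is $\Sigma$-measurable for every $H\in\mathcal{H}$ and, for every $x\in\mathcal{X}$, $H\mapsto\varepsilon(H\mid x)$ is an E-capacity, meaning $\varepsilon(\emptyset\mid x)=\infty$ and $\varepsilon(H'\mid x)\le\varepsilon(H\mid x)$ whenever $H\subseteq H'$, $H,H'\in\mathcal{H}$. $\mathbb{E}^P$ denotes expectation when $X\in\mathcal{X}$ has law $P$. *)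

theory Defs
  imports "HOL-Probability.Probability"
begin

text \<open>Hypotheses are subsets of the sample space. The empty intersection is read as
  \<open>\<X>\<close>, whence the separate membership clause and the restriction to nonempty families.\<close>

definition intersection_closed :: "'a set \<Rightarrow> 'a set set \<Rightarrow> bool" where
  "intersection_closed \<X> \<H> \<longleftrightarrow>
     \<H> \<subseteq> Pow \<X> \<and> \<X> \<in> \<H> \<and>
     (\<forall>\<A>\<subseteq>\<H>. \<Union>\<A> \<in> \<H>) \<and>
     (\<forall>\<A>\<subseteq>\<H>. \<A> \<noteq> {} \<longrightarrow> \<Inter>\<A> \<in> \<H>)"

definition least_hypothesis :: "'a set set \<Rightarrow> 'a \<Rightarrow> 'a set" where
  "least_hypothesis \<H> x = \<Inter>{H \<in> \<H>. x \<in> H}"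

definition e_capacity :: "'a set set \<Rightarrow> ('a set \<Rightarrow> ennreal) \<Rightarrow> bool" where
  "e_capacity \<H> e \<longleftrightarrow>
     e {} = \<infinity> \<and> (\<forall>H\<in>\<H>. \<forall>H'\<in>\<H>. H \<subseteq> H' \<longrightarrow> e H' \<le> e H)"

text \<open>The argument order is \<open>\<epsilon> H x\<close> for \<open>\<epsilon>(H | x)\<close>.\<close>

definition predictive_e_capacity_kernel ::
    "'a set \<Rightarrow> 'a set set \<Rightarrow> 'a set set \<Rightarrow> ('a set \<Rightarrow> 'a \<Rightarrow> ennreal) \<Rightarrow> bool" where
  "predictive_e_capacity_kernel \<X> \<Sigma> \<H> \<epsilon> \<longleftrightarrow>
     (\<forall>H\<in>\<H>. \<epsilon> H \<in> borel_measurable (sigma \<X> \<Sigma>)) \<and>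
     (\<forall>x\<in>\<X>. e_capacity \<H> (\<lambda>H. \<epsilon> H x))"

text \<open>Measurability of the supremum is not part of this definition. For a non-measurable
  integrand \<^const>\<open>nn_integral\<close> would be a lower integral.\<close>

definition predictively_valid ::
    "'a set set \<Rightarrow> 'a measure set \<Rightarrow> ('a set \<Rightarrow> 'a \<Rightarrow> ennreal) \<Rightarrow> bool" where
  "predictively_valid \<H> \<P> \<epsilon> \<longleftrightarrow>
     (\<forall>P\<in>\<P>. (\<integral>\<^sup>+ x. (SUP H\<in>{H \<in> \<H>. x \<in> H}. \<epsilon> H x) \<partial>P) \<le> 1)"

definition valid_e_variable ::
    "'a set \<Rightarrow> 'a set set \<Rightarrow> 'a measure set \<Rightarrow> ('a \<Rightarrow> ennreal) \<Rightarrow> bool" where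
  "valid_e_variable \<X> \<H> \<P> E \<longleftrightarrow>
     E \<in> borel_measurable (sigma \<X> \<H>) \<and> (\<forall>P\<in>\<P>. (\<integral>\<^sup>+ x. E x \<partial>P) \<le> 1)"

end

theory Submission imports Defs begin

text \<open>The supremum is attained at \<open>H\<^sub>x\<close> because \<open>\<epsilon>(\<cdot> | x)\<close> is antitone. Measurability of
  \<open>x \<mapsto> \<epsilon>(H\<^sub>x | x)\<close> is automatic: \<open>\<H>\<close> is closed under complements, so the least hypotheses
  partition \<open>\<X>\<close>, the map agrees on the block \<open>H\<^sub>y\<close> with the measurable map \<open>\<epsilon>(H\<^sub>y | \<cdot>)\<close>,
  and \<open>\<H>\<close> admits the possibly uncountable union over the blocks.\<close>

text \<open>De Morgan: an intersection is the complement of a union of complements. The family must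
  be nonempty for this, since \<open>\<Inter>{}\<close> is \<open>UNIV\<close> and not \<X>.\<close>

lemma intersection_closed_sigma_algebra:
  assumes "sigma_algebra \<X> \<H>" and Union_in: "\<And>\<A>. \<A> \<subseteq> \<H> \<Longrightarrow> \<Union>\<A> \<in> \<H>"
  shows "intersection_closed \<X> \<H>"
proof -
  interpret sigma_algebra \<X> \<H> by fact
  have "\<Inter>\<A> \<in> \<H>" if "\<A> \<subseteq> \<H>" "\<A> \<noteq> {}" for \<A>
  proof -
    have "\<Union>((\<lambda>A. \<X> - A) ` \<A>) \<in> \<H>"
      using that by (intro Union_in) auto
    then have "\<X> - \<Union>((\<lambda>A. \<X> - A) ` \<A>) \<in> \<H>" by (rule compl_sets)
    also have "\<X> - \<Union>((\<lambda>A. \<X> - A) ` \<A>) = \<Inter>\<A>"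
      using that sets_into_space by blast
    finally show ?thesis .
  qed
  then show ?thesis
    unfolding intersection_closed_def using space_closed Union_in by auto
qed

lemma mem_least_hypothesis: "x \<in> least_hypothesis \<H> x"
  by (simp add: least_hypothesis_def)

lemma least_hypothesis_subset: "H \<in> \<H> \<Longrightarrow> x \<in> H \<Longrightarrow> least_hypothesis \<H> x \<subseteq> H"
  by (auto simp: least_hypothesis_def)

lemma least_hypothesis_in:
  assumes "intersection_closed \<X> \<H>" and "x \<in> \<X>"
  shows "least_hypothesis \<H> x \<in> \<H>"
proof -
  \<comment> \<open>The family contains \<X> itself, so the clause for nonempty intersections
    applies.\<close>
  have "{H \<in> \<H>. x \<in> H} \<subseteq> \<H>" "{H \<in> \<H>. x \<in> H} \<noteq> {}"
    using assms by (auto simp: intersection_closed_def)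
  then show ?thesis
    using assms(1) unfolding least_hypothesis_def intersection_closed_def by blast
qed

text \<open>Least hypotheses are the blocks of a partition. The point is symmetry: were
  \<open>y\<close> outside the least hypothesis of \<open>z\<close>, removing that set from the
  least hypothesis of \<open>y\<close> would leave a hypothesis that still contains \<open>y\<close>
  but has lost \<open>z\<close>, against minimality. Closure under differences enters here.\<close>

lemma least_hypothesis_eq:
  assumes "ring_of_sets \<X> \<H>" and "intersection_closed \<X> \<H>"
    and "y \<in> \<X>" and z: "z \<in> least_hypothesis \<H> y"
  shows "least_hypothesis \<H> z = least_hypothesis \<H> y"
proof
  interpret ring_of_sets \<X> \<H> by fact
  have Hy: "least_hypothesis \<H> y \<in> \<H>"
    using assms by (intro least_hypothesis_in)
  with z show "least_hypothesis \<H> z \<subseteq> least_hypothesis \<H> y"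
    by (intro least_hypothesis_subset)
  have Hz: "least_hypothesis \<H> z \<in> \<H>"
    using sets_into_space[OF Hy] z by (intro least_hypothesis_in[OF assms(2)]) auto
  have "y \<in> least_hypothesis \<H> z"
  proof (rule ccontr)
    assume "y \<notin> least_hypothesis \<H> z"
    then have "least_hypothesis \<H> y \<subseteq> least_hypothesis \<H> y - least_hypothesis \<H> z"
      using Hy Hz by (intro least_hypothesis_subset) (auto simp: mem_least_hypothesis)
    with z mem_least_hypothesis[of z \<H>] show False by blast
  qed
  with Hz show "least_hypothesis \<H> y \<subseteq> least_hypothesis \<H> z"
    by (intro least_hypothesis_subset)
qed

lemma SUP_e_capacity:
  assumes "intersection_closed \<X> \<H>" and "e_capacity \<H> e" and "x \<in> \<X>"
  shows "(SUP H\<in>{H \<in> \<H>. x \<in> H}. e H) = e (least_hypothesis \<H> x)"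
proof (rule antisym)
  have Hx: "least_hypothesis \<H> x \<in> \<H>"
    using assms by (intro least_hypothesis_in)
  then show "(SUP H\<in>{H \<in> \<H>. x \<in> H}. e H) \<le> e (least_hypothesis \<H> x)"
    using assms(2) least_hypothesis_subset[of _ \<H> x]
    by (intro SUP_least) (auto simp: e_capacity_def)
  show "e (least_hypothesis \<H> x) \<le> (SUP H\<in>{H \<in> \<H>. x \<in> H}. e H)"
    using Hx by (intro SUP_upper) (simp add: mem_least_hypothesis)
qed

text \<open>Letting the index of \<open>f\<close> vary with the argument could destroy
  measurability; here the index is constant on each block of the partition.\<close>

lemma measurable_least_hypothesis_diagonal:
  assumes "sigma_algebra \<X> \<H>" and Union_in: "\<And>\<A>. \<A> \<subseteq> \<H> \<Longrightarrow> \<Union>\<A> \<in> \<H>"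
    and meas: "\<And>H. H \<in> \<H> \<Longrightarrow> f H \<in> measurable (sigma \<X> \<H>) N"
  shows "(\<lambda>x. f (least_hypothesis \<H> x) x) \<in> measurable (sigma \<X> \<H>) N"
proof -
  interpret sigma_algebra \<X> \<H> by fact
  note ic = intersection_closed_sigma_algebra[OF assms(1) Union_in]
  have space: "space (sigma \<X> \<H>) = \<X>" and sets: "sets (sigma \<X> \<H>) = \<H>"
    using space_closed by (simp_all add: space_measure_of sigma_sets_eq)
  show ?thesis
  proof (rule measurableI)
    fix x assume "x \<in> space (sigma \<X> \<H>)"
    then show "f (least_hypothesis \<H> x) x \<in> space N"
      using measurable_space[OF meas] least_hypothesis_in[OF ic] by (simp add: space)
  next
    fix B assume B: "B \<in> sets N"
    \<comment> \<open>The part of the preimage of \<open>B\<close> that lies in the block of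
      \<open>y\<close>, computed with the index frozen at that block.\<close>
    let ?A = "\<lambda>y. least_hypothesis \<H> y \<inter> (f (least_hypothesis \<H> y) -` B \<inter> \<X>)"
    have "?A y \<in> \<H>" if "y \<in> \<X>" for y
      using least_hypothesis_in[OF ic that] measurable_sets[OF meas B, of "least_hypothesis \<H> y"]
      by (simp add: space sets Int)
    then have "\<Union>(?A ` \<X>) \<in> \<H>"
      by (intro Union_in) auto
    also have "\<Union>(?A ` \<X>) = (\<lambda>x. f (least_hypothesis \<H> x) x) -` B \<inter> \<X>"
    proof (intro equalityI subsetI)
      fix x assume "x \<in> \<Union>(?A ` \<X>)"
      then obtain y where "y \<in> \<X>" "x \<in> ?A y" by blast
      moreover from this have "least_hypothesis \<H> x = least_hypothesis \<H> y"
        by (intro least_hypothesis_eq[OF ring_of_sets_axioms ic]) auto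
      ultimately show "x \<in> (\<lambda>x. f (least_hypothesis \<H> x) x) -` B \<inter> \<X>" by simp
    next
      fix x assume "x \<in> (\<lambda>x. f (least_hypothesis \<H> x) x) -` B \<inter> \<X>"
      then have "x \<in> \<X>" "x \<in> ?A x" by (simp_all add: mem_least_hypothesis)
      then show "x \<in> \<Union>(?A ` \<X>)" by (rule UN_I)
    qed
    finally show "(\<lambda>x. f (least_hypothesis \<H> x) x) -` B \<inter> space (sigma \<X> \<H>)
        \<in> sets (sigma \<X> \<H>)"
      by (simp only: space sets)
  qed
qed

theorem theorem10:
  fixes \<X> :: "'a set" and \<Sigma> \<H> :: "'a set set"
    and \<P> :: "'a measure set" and \<epsilon> :: "'a set \<Rightarrow> 'a \<Rightarrow> ennreal"
  assumes "sigma_algebra \<X> \<Sigma>" and "sigma_algebra \<X> \<H>" and "\<Sigma> \<subseteq> \<H>"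
    and "\<And>\<A>. \<A> \<subseteq> \<H> \<Longrightarrow> \<Union>\<A> \<in> \<H>"
    and "\<And>P. P \<in> \<P> \<Longrightarrow> prob_space P \<and> space P = \<X> \<and> sets P = \<H>"
    and "predictive_e_capacity_kernel \<X> \<Sigma> \<H> \<epsilon>"
  shows "intersection_closed \<X> \<H> \<and>
    (\<forall>x\<in>\<X>. (SUP H\<in>{H \<in> \<H>. x \<in> H}. \<epsilon> H x) = \<epsilon> (least_hypothesis \<H> x) x) \<and>
    (predictively_valid \<H> \<P> \<epsilon> \<longleftrightarrow>
      valid_e_variable \<X> \<H> \<P> (\<lambda>x. \<epsilon> (least_hypothesis \<H> x) x))"
proof (intro conjI ballI)
  interpret sigma_algebra \<X> \<H> by fact
  show ic: "intersection_closed \<X> \<H>"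
    by (rule intersection_closed_sigma_algebra[OF assms(2,4)])
  show sup: "(SUP H\<in>{H \<in> \<H>. x \<in> H}. \<epsilon> H x) = \<epsilon> (least_hypothesis \<H> x) x"
    if "x \<in> \<X>" for x
    using ic assms(6) that
    by (intro SUP_e_capacity) (auto simp: predictive_e_capacity_kernel_def)
  have eps: "\<epsilon> H \<in> borel_measurable (sigma \<X> \<H>)" if "H \<in> \<H>" for H
  \<comment> \<open>Measurability survives the passage from \<Sigma> to the larger \<sigma>-algebra
    \<H> on the domain.\<close>
  proof (rule subsetD[OF measurable_mono1[OF space_closed assms(3)]])
    show "\<epsilon> H \<in> borel_measurable (sigma \<X> \<Sigma>)"
      using assms(6) that by (simp add: predictive_e_capacity_kernel_def)
  qed
  have "(\<lambda>x. \<epsilon> (least_hypothesis \<H> x) x) \<in> borel_measurable (sigma \<X> \<H>)"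
    by (rule measurable_least_hypothesis_diagonal[where f = \<epsilon>, OF assms(2,4) eps])
  moreover have "(\<integral>\<^sup>+ x. (SUP H\<in>{H \<in> \<H>. x \<in> H}. \<epsilon> H x) \<partial>P)
      = (\<integral>\<^sup>+ x. \<epsilon> (least_hypothesis \<H> x) x \<partial>P)" if "P \<in> \<P>" for P
    \<comment> \<open>The integrands need to agree only on \<open>space P\<close>, which is
      \<X>.\<close>
    using assms(5)[OF that] by (intro nn_integral_cong sup) simp
  ultimately show "predictively_valid \<H> \<P> \<epsilon> \<longleftrightarrow>
      valid_e_variable \<X> \<H> \<P> (\<lambda>x. \<epsilon> (least_hypothesis \<H> x) x)"
    by (simp add: predictively_valid_def valid_e_variable_def)
qed

end
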